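(* Let $q$ be a positive integer and let $A\subseteq\mathbb{Z}_q$ be a nonempty set with $|A|=\alpha q$. Suppose that the least prime factor of $q$ is greater than $2\alpha^{-1}+3$. Then there is a set $X\subseteq\mathbb{Z}_q$ such that $$|X|\le\frac{1}{\alpha}+1$$ and $$X(A-A)=\mathbb{Z}_q.$$
   Context: $\mathbb{Z}_q=\mathbb{Z}/q\mathbb{Z}$. For $X,Y\subseteq\mathbb{Z}_q$: $X-Y=\{x-y: x\in X,y\in Y\}$ and $XY=\{xy: x\in X,y\in Y\}$. *)

theory Defs
  imports Complex_Main "HOL-Algebra.IntRing" "HOL-Algebra.Coset"
    "HOL-Computational_Algebra.Primes"
begin

text \<open>
  The ring of integers modulo \<open>q\<close> is \<open>ZFact (int q)\<close>, the quotient of \<open>\<Z>\<close> by the ideal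
  generated by \<open>q\<close>; its elements are residue classes. The product set \<open>XY\<close> is \<open>X <#>\<^bsub>R\<^esub> Y\<close>.
  \<open>diff_set\<close> is the set of differences of elements, not the set-theoretic difference.
\<close>

definition diff_set :: "('a, 'm) ring_scheme \<Rightarrow> 'a set \<Rightarrow> 'a set \<Rightarrow> 'a set"
  where "diff_set R X Y = {x \<ominus>\<^bsub>R\<^esub> y | x y. x \<in> X \<and> y \<in> Y}"

end

theory Submission
  imports Defs
begin

text \<open>
  Let \<open>k\<close> be the least integer greater than \<open>1/\<alpha>\<close> and let \<open>d\<close> be a residue. The \<open>k\<close> translates
  \<open>A + i d\<close> with \<open>0 \<le> i < k\<close> have total size greater than \<open>q\<close>, so two of them meet, and hence
  \<open>t d \<in> A - A\<close> for some \<open>1 \<le> t < k\<close>. Since \<open>t \<le> 1/\<alpha>\<close> is smaller than every prime factor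
  of \<open>q\<close>, it is invertible modulo \<open>q\<close>. The inverses of \<open>1, \<dots>, k - 1\<close> therefore form a suitable \<open>X\<close>.
\<close>

lemma (in abelian_group) exists_multiple_in_diff_set:
  assumes fin: "finite (carrier G)" and A: "A \<subseteq> carrier G" and d: "d \<in> carrier G"
    and card: "card (carrier G) < k * card A"
  shows "\<exists>t::nat. 0 < t \<and> t < k \<and> [t] \<cdot> d \<in> diff_set G A A"
proof -
  define f where "f = (\<lambda>(i::nat, a). [i] \<cdot> d \<oplus> a)"
  have "f ` ({..<k} \<times> A) \<subseteq> carrier G"
    using A d by (auto simp: f_def)
  hence "card (f ` ({..<k} \<times> A)) \<le> card (carrier G)"
    by (rule card_mono[OF fin])
  hence "card (f ` ({..<k} \<times> A)) < card ({..<k} \<times> A)"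
    using card by (simp add: card_cartesian_product)
  hence "\<not> inj_on f ({..<k} \<times> A)"
    by (rule pigeonhole)
  then obtain i j a b where ij: "i < k" "j < k" and ab: "a \<in> A" "b \<in> A"
    and neq: "(i, a) \<noteq> (j, b)" and eq: "[i] \<cdot> d \<oplus> a = [j] \<cdot> d \<oplus> b"
    by (auto simp: inj_on_def f_def)
  \<comment> \<open>Natural subtraction truncates, so a collision has to be read with the smaller
    index first. Stating this for generic \<open>m < n\<close> serves both orders of
    \<open>i\<close> and \<open>j\<close>.\<close>
  have key: "[(n - m)] \<cdot> d \<in> diff_set G A A"
    if "m < n" "x \<in> A" "y \<in> A" "[m] \<cdot> d \<oplus> x = [n] \<cdot> d \<oplus> y" for m n :: nat and x y
  proof -
    have xy: "x \<in> carrier G" "y \<in> carrier G"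
      using that A by auto
    have "[n] \<cdot> d = [m] \<cdot> d \<oplus> [(n - m)] \<cdot> d"
      using add.nat_pow_mult[OF d, of m "n - m"] \<open>m < n\<close> by simp
    hence "[m] \<cdot> d \<oplus> x = [m] \<cdot> d \<oplus> ([(n - m)] \<cdot> d \<oplus> y)"
      using that(4) d xy by (simp add: a_assoc)
    hence "x = [(n - m)] \<cdot> d \<oplus> y"
      using d xy by simp
    hence "[(n - m)] \<cdot> d = x \<ominus> y"
      using d xy by (simp add: a_minus_def a_assoc r_neg)
    thus ?thesis
      unfolding diff_set_def using that by blast
  qed
  \<comment> \<open>This makes the resulting multiple positive: colliding pairs with equal indices
    would, by cancellation, have equal second components too.\<close>
  have "i \<noteq> j"
  proof
    assume "i = j"
    moreover from this have "a = b"
      using eq d subsetD[OF A] ab by simp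
    ultimately show False
      using neq by simp
  qed
  then consider "i < j" | "j < i"
    by linarith
  thus ?thesis
  proof cases
    case 1
    thus ?thesis
      using key[OF 1 ab eq] ij by (intro exI[of _ "j - i"]) auto
  next
    case 2
    thus ?thesis
      using key[OF 2 ab(2,1) eq[symmetric]] ij by (intro exI[of _ "i - j"]) auto
  qed
qed

text \<open>Each \<open>d\<close> has some multiple \<open>[t] \<cdot> d\<close> in the difference
  set with \<open>0 < t < k\<close>. Multiplying by the inverse of \<open>[t] \<cdot> \<one>\<close>
  recovers \<open>d\<close>, and \<open>t\<close> ranges over a set that does not depend on
  \<open>d\<close>.\<close>

lemma (in cring) inv_multiples_mult_diff_set:
  assumes fin: "finite (carrier R)" and A: "A \<subseteq> carrier R"
    and card: "card (carrier R) < k * card A"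
    and units: "\<And>t::nat. 0 < t \<Longrightarrow> t < k \<Longrightarrow> [t] \<cdot> \<one> \<in> Units R"
  shows "(\<lambda>t::nat. inv ([t] \<cdot> \<one>)) ` {0<..<k} <#> diff_set R A A = carrier R"
proof (intro equalityI subsetI)
  fix z assume "z \<in> (\<lambda>t::nat. inv ([t] \<cdot> \<one>)) ` {0<..<k} <#> diff_set R A A"
  thus "z \<in> carrier R"
    using subsetD[OF A] units by (auto simp: set_mult_def diff_set_def)
next
  fix d assume d: "d \<in> carrier R"
  obtain t :: nat where t: "0 < t" "t < k" and mem: "[t] \<cdot> d \<in> diff_set R A A"
    using exists_multiple_in_diff_set[OF fin A d card] by blast
  have "inv ([t] \<cdot> \<one>) \<otimes> [t] \<cdot> d = inv ([t] \<cdot> \<one>) \<otimes> ([t] \<cdot> \<one> \<otimes> d)"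
    using d by (simp add: add_pow_ldistr)
  also have "\<dots> = d"
    using units[OF t] d by (simp add: m_assoc[symmetric])
  finally show "d \<in> (\<lambda>t::nat. inv ([t] \<cdot> \<one>)) ` {0<..<k} <#> diff_set R A A"
    unfolding set_mult_def using t mem by force
qed

lemma ZMod_ring_hom: "ZMod k \<in> ring_hom \<Z> (ZFact k)"
proof -
  have "ZMod k = (+>\<^bsub>\<Z>\<^esub>) (Idl\<^bsub>\<Z>\<^esub> {k})"
    by (simp add: ZMod_def fun_eq_iff)
  thus ?thesis
    unfolding ZFact_def by (simp add: ideal.rcos_ring_hom int.genideal_ideal)
qed

lemma carrier_ZFact: "carrier (ZFact k) = range (ZMod k)"
  by (auto simp: ZFact_defs A_RCOSETS_def' ZMod_def)

text \<open>Every class has exactly one representative among the remainders modulo \<open>k\<close>.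
  This supplies the finiteness and the size of the residue ring.\<close>

lemma bij_betw_ZMod:
  assumes "k > 0"
  shows "bij_betw (ZMod k) {0..<k} (carrier (ZFact k))"
proof (rule bij_betw_imageI)
  show "inj_on (ZMod k) {0..<k}"
    by (auto simp: inj_on_def ZMod_eq_mod)
  show "ZMod k ` {0..<k} = carrier (ZFact k)"
  proof -
    have "ZMod k x \<in> ZMod k ` {0..<k}" for x
      using assms by (subst ZMod_mod) auto
    thus ?thesis
      unfolding carrier_ZFact by blast
  qed
qed

text \<open>Links the multiples of one in the abstract ring argument with integer residues, by
  induction along the projection homomorphism.\<close>

lemma ZFact_add_pow_one: "[n] \<cdot>\<^bsub>ZFact k\<^esub> \<one>\<^bsub>ZFact k\<^esub> = ZMod k (int n)"
proof -
  interpret R: cring "ZFact k"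
    by (rule ZFact_is_cring)
  interpret h: ring_hom_ring \<Z> "ZFact k" "ZMod k"
    using ZMod_ring_hom by (intro ring_hom_ringI2) (auto intro: R.ring_axioms int.ring_axioms)
  show ?thesis
  proof (induction n)
    case 0
    show ?case
      using h.hom_zero by simp
  next
    case (Suc n)
    have "ZMod k (int n + 1) = ZMod k (int n) \<oplus>\<^bsub>ZFact k\<^esub> \<one>\<^bsub>ZFact k\<^esub>"
      using h.hom_add[of "int n" 1] h.hom_one by simp
    thus ?case
      using Suc by (simp add: add.commute)
  qed
qed

text \<open>A Bezout identity \<open>u * int n + v * k = 1\<close>, read modulo \<open>k\<close>,
  exhibits the class of \<open>u\<close> as the inverse.\<close>

lemma ZFact_add_pow_one_Units:
  assumes "coprime (int n) k"
  shows "[n] \<cdot>\<^bsub>ZFact k\<^esub> \<one>\<^bsub>ZFact k\<^esub> \<in> Units (ZFact k)"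
proof -
  interpret R: cring "ZFact k"
    by (rule ZFact_is_cring)
  obtain u v where "u * int n + v * k = 1"
    using bezout_int[of "int n" k] assms by auto
  hence "(int n * u) mod k = 1 mod k"
    by (metis mod_mult_self1 mult.commute)
  hence "ZMod k (int n) \<otimes>\<^bsub>ZFact k\<^esub> ZMod k u = \<one>\<^bsub>ZFact k\<^esub>"
    using ring_hom_mult[OF ZMod_ring_hom, of "int n" u k] ring_hom_one[OF ZMod_ring_hom]
    by (simp add: ZMod_eq_mod[symmetric])
  moreover have "ZMod k (int n) \<in> carrier (ZFact k)" "ZMod k u \<in> carrier (ZFact k)"
    by (simp_all add: carrier_ZFact)
  ultimately show ?thesis
    unfolding ZFact_add_pow_one Units_def by (auto intro: bexI[of _ "ZMod k u"] simp: R.m_comm)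
qed

text \<open>A common prime factor \<open>p\<close> would divide \<open>n\<close>, forcing
  \<open>p \<le> n\<close>, although \<open>n\<close> lies below every prime factor of
  \<open>q\<close>.\<close>

lemma coprime_if_less_prime_factors:
  fixes n q :: nat
  assumes "0 < n" and "\<And>p. p \<in> prime_factors q \<Longrightarrow> n < p" and "0 < q"
  shows "coprime n q"
proof (rule ccontr)
  assume "\<not> coprime n q"
  then obtain p where p: "prime p" "p dvd n" "p dvd q"
    by (metis coprime_iff_gcd_eq_1 dvd_trans gcd_dvd1 gcd_dvd2 prime_factor_nat)
  hence "n < p"
    using assms by (simp add: prime_factors_dvd)
  thus False
    using p assms(1) by (auto dest: dvd_imp_le)
qed

theorem theorem4:
  fixes q :: nat and A :: "int set set" and \<alpha> :: real
  assumes "q > 0"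
    and "A \<subseteq> carrier (ZFact (int q))" and "A \<noteq> {}"
    and "real (card A) = \<alpha> * real q"
    and "q > 1 \<Longrightarrow> real (Min (prime_factors q)) > 2 * inverse \<alpha> + 3"
  shows "\<exists>X. X \<subseteq> carrier (ZFact (int q)) \<and> real (card X) \<le> 1 / \<alpha> + 1 \<and>
    X <#>\<^bsub>ZFact (int q)\<^esub> diff_set (ZFact (int q)) A A = carrier (ZFact (int q))"
proof -
  interpret R: cring "ZFact (int q)"
    by (rule ZFact_is_cring)
  have bij: "bij_betw (ZMod (int q)) {0..<int q} (carrier (ZFact (int q)))"
    using assms(1) by (intro bij_betw_ZMod) simp
  have fin: "finite (carrier (ZFact (int q)))"
    using bij_betw_finite[OF bij] by simp
  have card_R: "card (carrier (ZFact (int q))) = q"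
    using bij_betw_same_card[OF bij] by simp
  have "card A > 0"
    using assms(2,3) fin by (simp add: card_gt_0_iff finite_subset)
  hence "0 < \<alpha> * real q"
    using assms(4) by linarith
  hence \<alpha>: "\<alpha> > 0"
    using assms(1) by (simp add: zero_less_mult_iff)
  \<comment> \<open>The least integer above \<open>1 / \<alpha>\<close>: being strictly above gives
    \<open>k * card A > q\<close> for the pigeonhole, and exceeding it by at most 1 gives the bound
    on the size of \<open>X\<close>.\<close>
  define k where "k = nat \<lfloor>1 / \<alpha>\<rfloor> + 1"
  have "1 / \<alpha> < real k" and k_le: "real k \<le> 1 / \<alpha> + 1"
    unfolding k_def using \<alpha> by (simp_all, linarith)
  hence "1 < real k * \<alpha>"
    using \<alpha> by (simp add: field_simps)
  hence "real q < real k * real (card A)"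
    using assms(1,4) by simp
  hence card: "card (carrier (ZFact (int q))) < k * card A"
    unfolding card_R by (metis of_nat_less_iff of_nat_mult)
  have units: "[t] \<cdot>\<^bsub>ZFact (int q)\<^esub> \<one>\<^bsub>ZFact (int q)\<^esub> \<in> Units (ZFact (int q))"
    if t: "0 < t" "t < k" for t :: nat
  proof -
    \<comment> \<open>For \<open>q = 1\<close> there are no prime factors and the claim is vacuous.
      Otherwise \<open>t < k \<le> 1 / \<alpha> + 1\<close>, which lies below the least prime
      factor.\<close>
    have "t < p" if p: "p \<in> prime_factors q" for p
    proof -
      have "q \<noteq> 1"
        using p by auto
      hence "2 * inverse \<alpha> + 3 < real (Min (prime_factors q))"
        using assms(1,5) by simp
      also have "\<dots> \<le> real p"
        using p by simp
      finally have "2 * (1 / \<alpha>) + 3 < real p"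
        by (simp add: inverse_eq_divide)
      moreover have "real t < real k" "0 < 1 / \<alpha>"
        using t(2) \<alpha> by simp_all
      ultimately have "real t < real p"
        using k_le by linarith
      thus ?thesis
        by simp
    qed
    hence "coprime t q"
      using assms(1) t by (intro coprime_if_less_prime_factors)
    thus ?thesis
      by (intro ZFact_add_pow_one_Units) simp
  qed
  let ?X = "(\<lambda>t::nat. inv\<^bsub>ZFact (int q)\<^esub> ([t] \<cdot>\<^bsub>ZFact (int q)\<^esub> \<one>\<^bsub>ZFact (int q)\<^esub>)) ` {0<..<k}"
  have "card ?X \<le> k"
    using card_image_le[of "{0<..<k}"] by (rule order_trans) auto
  hence "real (card ?X) \<le> 1 / \<alpha> + 1"
    using k_le by linarith
  moreover have "?X \<subseteq> carrier (ZFact (int q))"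
    using units by auto
  ultimately show ?thesis
    using R.inv_multiples_mult_diff_set[OF fin assms(2) card units] by blast
qed

end
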